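(* Let $M$ be an infinite (pointed) metric space with metric $d$ satisfying at least one of the following conditions: (a) $\sup\{d(x,y): x,y\in M,\ x\neq y\}=\infty$; (b) $\inf\{d(x,y): x,y\in M,\ x\neq y\}=0$; (c) $M$ is a discrete metric space; (d) $M=K_n$, where $n\in\{1,2\}$. Then $\mathrm{Lip}_0(M)$ has the w$^*$-SSD2P.
   Context: All Banach spaces are over the real field. A pointed metric space is a metric space $M$ with a distinguished base point denoted $0$. $\mathrm{Lip}_0(M)$ is the Banach space of all Lipschitz functions $f:M\to\mathbb{R}$ with $f(0)=0$, with norm $\|f\|=\sup\{|f(x)-f(y)|/d(x,y): x,y\in M,\ x\neq y\}$. It is a dual space with canonical predual the Lipschitz-free space $\mathcal{F}(M)$, the norm closed linear subspace of $\mathrm{Lip}_0(M)^*$ spanned by the evaluation functionals $\delta_x$, $\delta_x(f)=f(x)$, $x\in M$. For a dual Banach space $X^*$ (with predual $X$), $B_{X^*}$ denotes its closed unit ball, and a weak$^*$ slice of $B_{X^*}$ is a set $\{x^*\in B_{X^*}: x^*(x)>1-\alpha\}$ with $x\in X$, $\|x\|=1$, and $\alpha>0$. $X^*$ has the weak$^*$ symmetric strong diameter 2 property (w$^*$-SSD2P) if for every finite family $\{S_i\}_{i=1}^n$ of weak$^*$ slices of $B_{X^*}$ and every $\varepsilon>0$ there exist $x_i^*\in S_i$ and $y^*\in B_{X^*}$, with $y^*$ independent of $i$, such that $x_i^*\pm y^*\in S_i$ for every $i\in\{1,\dots,n\}$ and $\|y^*\|>1-\varepsilon$. For $\mathrm{Lip}_0(M)$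 this is understood with respect to the predual $\mathcal{F}(M)$. A discrete metric space is one with $d(x,y)=1$ for all $x\neq y$. For $n\in\mathbb{N}$, $K_n=\{x\in\ell_\infty: x(k)\in\{0,1,\dots,n\}\text{ for all }k\in\mathbb{N}\}$ with the metric inherited from $\ell_\infty$, i.e. $d(x,y)=\sup_k|x(k)-y(k)|$. *)

theory Defs
  imports "HOL-Analysis.Analysis" "HOL-Library.Extended_Real"
begin

class pointed_metric_space = metric_space +
  fixes basepoint :: 'a

typedef (overloaded) 'a lip0 =
  "{f :: 'a::pointed_metric_space \<Rightarrow> real. f basepoint = 0 \<and> (\<exists>C. C-lipschitz_on UNIV f)}"
  morphisms lip0_apply Abs_lip0
  by (rule exI[of _ "\<lambda>_. 0"]) (auto intro: lipschitz_on_constant)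

setup_lifting type_definition_lip0

lemma lip0_basepoint: "lip0_apply f basepoint = 0"
  using lip0_apply[of f] by simp

lemma lip0_bound:
  obtains C where "0 \<le> C" "\<And>x y. \<bar>lip0_apply f x - lip0_apply f y\<bar> \<le> C * dist x y"
  using lip0_apply[of f] by (auto simp: lipschitz_on_def dist_real_def)

instantiation lip0 :: (pointed_metric_space) real_vector
begin

lift_definition zero_lip0 :: "'a lip0" is "\<lambda>_. 0"
  by (auto intro: lipschitz_on_constant)

lift_definition plus_lip0 :: "'a lip0 \<Rightarrow> 'a lip0 \<Rightarrow> 'a lip0" is "\<lambda>f g x. f x + g x"
  by (auto intro: lipschitz_on_add)

lift_definition uminus_lip0 :: "'a lip0 \<Rightarrow> 'a lip0" is "\<lambda>f x. - f x"
  by auto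

lift_definition minus_lip0 :: "'a lip0 \<Rightarrow> 'a lip0 \<Rightarrow> 'a lip0" is "\<lambda>f g x. f x - g x"
  by (auto intro: lipschitz_on_diff)

lift_definition scaleR_lip0 :: "real \<Rightarrow> 'a lip0 \<Rightarrow> 'a lip0" is "\<lambda>c f x. c * f x"
  by (auto intro: lipschitz_on_cmult_real)

instance
  by (standard; transfer; simp add: algebra_simps)

end

instantiation lip0 :: (pointed_metric_space) real_normed_vector
begin

text \<open>The value 0 is inserted so that the supremum is 0 on a one-point space; otherwise it changes
  nothing, all the quotients being nonnegative.\<close>

definition norm_lip0 :: "'a lip0 \<Rightarrow> real" where
  "norm_lip0 f =
     Sup (insert 0 {\<bar>lip0_apply f x - lip0_apply f y\<bar> / dist x y | x y. x \<noteq> y})"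

definition dist_lip0 :: "'a lip0 \<Rightarrow> 'a lip0 \<Rightarrow> real" where
  "dist_lip0 f g = norm (f - g)"

definition sgn_lip0 :: "'a lip0 \<Rightarrow> 'a lip0" where
  "sgn_lip0 f = f /\<^sub>R norm f"

definition uniformity_lip0 :: "('a lip0 \<times> 'a lip0) filter" where
  "uniformity_lip0 = (INF e\<in>{0<..}. principal {(f, g). dist f g < e})"

definition open_lip0 :: "'a lip0 set \<Rightarrow> bool" where
  "open_lip0 U \<longleftrightarrow> (\<forall>f\<in>U. eventually (\<lambda>(f', g). f' = f \<longrightarrow> g \<in> U) uniformity)"

lemma lip0_bdd_above:
  "bdd_above (insert 0 {\<bar>lip0_apply f x - lip0_apply f y\<bar> / dist x y | x y. x \<noteq> y})"
proof -
  obtain C where "0 \<le> C" "\<And>x y. \<bar>lip0_apply f x - lip0_apply f y\<bar> \<le> C * dist x y"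
    using lip0_bound[of f] by blast
  then show ?thesis
    by (intro bdd_aboveI[of _ C]) (auto simp: divide_le_eq)
qed

lemma lip0_norm_nonneg: "0 \<le> norm (f :: 'a lip0)"
  unfolding norm_lip0_def by (rule cSup_upper[OF _ lip0_bdd_above]) simp

lemma lip0_diff_le: "\<bar>lip0_apply f x - lip0_apply f y\<bar> \<le> norm f * dist x y"
proof (cases "x = y")
  case False
  then have "\<bar>lip0_apply f x - lip0_apply f y\<bar> / dist x y \<le> norm f"
    unfolding norm_lip0_def by (intro cSup_upper[OF _ lip0_bdd_above]) auto
  with False show ?thesis
    by (simp add: divide_le_eq)
qed simp

lemma lip0_norm_le:
  assumes "0 \<le> C" "\<And>x y. \<bar>lip0_apply f x - lip0_apply f y\<bar> \<le> C * dist x y"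
  shows "norm f \<le> C"
  unfolding norm_lip0_def using assms by (intro cSup_least) (auto simp: divide_le_eq)

lemma lip0_norm_scaleR_le: "norm (c *\<^sub>R f) \<le> \<bar>c\<bar> * norm (f :: 'a lip0)"
proof (rule lip0_norm_le)
  fix x y
  have "\<bar>lip0_apply (c *\<^sub>R f) x - lip0_apply (c *\<^sub>R f) y\<bar>
      = \<bar>c\<bar> * \<bar>lip0_apply f x - lip0_apply f y\<bar>"
    by (simp add: scaleR_lip0.rep_eq flip: abs_mult right_diff_distrib)
  also have "\<dots> \<le> \<bar>c\<bar> * (norm f * dist x y)"
    by (intro mult_left_mono lip0_diff_le) simp
  finally show "\<bar>lip0_apply (c *\<^sub>R f) x - lip0_apply (c *\<^sub>R f) y\<bar> \<le> \<bar>c\<bar> * norm f * dist x y"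
    by (simp add: mult.assoc)
qed (simp add: lip0_norm_nonneg)

instance
proof
  fix f g :: "'a lip0" and c :: real
  show "dist f g = norm (f - g)"
    by (rule dist_lip0_def)
  show "sgn f = f /\<^sub>R norm f"
    by (rule sgn_lip0_def)
  show "uniformity = (INF e\<in>{0<..}. principal {(f, g :: 'a lip0). dist f g < e})"
    by (rule uniformity_lip0_def)
  show "open U \<longleftrightarrow> (\<forall>f\<in>U. eventually (\<lambda>(f', g). f' = f \<longrightarrow> g \<in> U) uniformity)"
    for U :: "'a lip0 set"
    by (rule open_lip0_def)
  show "norm f = 0 \<longleftrightarrow> f = 0"
  proof
    assume "norm f = 0"
    then have "lip0_apply f x = 0" for x
      using lip0_diff_le[of f x basepoint] by (simp add: lip0_basepoint)
    then show "f = 0"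
      by transfer auto
  next
    assume "f = 0"
    then have "norm f \<le> 0"
      by (intro lip0_norm_le) (auto simp: zero_lip0.rep_eq)
    then show "norm f = 0"
      using lip0_norm_nonneg[of f] by simp
  qed
  show "norm (f + g) \<le> norm f + norm g"
  proof (rule lip0_norm_le)
    fix x y
    show "\<bar>lip0_apply (f + g) x - lip0_apply (f + g) y\<bar> \<le> (norm f + norm g) * dist x y"
      using lip0_diff_le[of f x y] lip0_diff_le[of g x y]
      by (simp add: plus_lip0.rep_eq distrib_right)
  qed (simp add: lip0_norm_nonneg)
  show "norm (c *\<^sub>R f) = \<bar>c\<bar> * norm f"
  proof (cases "c = 0")
    case True
    then show ?thesis
      using lip0_norm_scaleR_le[of c f] lip0_norm_nonneg[of "c *\<^sub>R f"] by simp
  next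
    case False
    then have "norm f \<le> \<bar>inverse c\<bar> * norm (c *\<^sub>R f)"
      using lip0_norm_scaleR_le[of "inverse c" "c *\<^sub>R f"] by simp
    with False have "\<bar>c\<bar> * norm f \<le> norm (c *\<^sub>R f)"
      by (simp add: field_simps)
    with lip0_norm_scaleR_le[of c f] show ?thesis
      by simp
  qed
qed

end

lift_definition delta :: "'a::pointed_metric_space \<Rightarrow> ('a lip0 \<Rightarrow>\<^sub>L real)" is
  "\<lambda>x f. lip0_apply f x"
proof -
  fix x :: 'a
  show "bounded_linear (\<lambda>f. lip0_apply f x)"
  proof (rule bounded_linear_intro[of _ "dist x basepoint"])
    fix f :: "'a lip0"
    show "norm (lip0_apply f x) \<le> norm f * dist x basepoint"
      using lip0_diff_le[of f x basepoint] by (simp add: lip0_basepoint)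
  qed (simp_all add: plus_lip0.rep_eq scaleR_lip0.rep_eq)
qed

definition lipschitz_free :: "('a::pointed_metric_space lip0 \<Rightarrow>\<^sub>L real) set" where
  "lipschitz_free = closure (span (range delta))"

text \<open>A predual of a dual Banach space \<open>'y\<close> is given by its canonical image \<open>P\<close> in the dual
  of \<open>'y\<close>, on which the duality pairing is evaluation.\<close>

definition wstar_slices :: "('y::real_normed_vector \<Rightarrow>\<^sub>L real) set \<Rightarrow> 'y set set" where
  "wstar_slices P =
     {{y \<in> cball 0 1. blinfun_apply \<mu> y > 1 - \<alpha>} | \<mu> \<alpha>. \<mu> \<in> P \<and> norm \<mu> = 1 \<and> \<alpha> > 0}"

definition wstar_SSD2P :: "('y::real_normed_vector \<Rightarrow>\<^sub>L real) set \<Rightarrow> bool" where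
  "wstar_SSD2P P \<longleftrightarrow>
     (\<forall>(n::nat) S \<epsilon>. (\<forall>i\<in>{1..n}. S i \<in> wstar_slices P) \<and> \<epsilon> > 0 \<longrightarrow>
        (\<exists>x. \<exists>y\<in>cball 0 1.
           (\<forall>i\<in>{1..n}. x i \<in> S i \<and> x i + y \<in> S i \<and> x i - y \<in> S i) \<and> norm y > 1 - \<epsilon>))"

text \<open>Since \<^typ>\<open>nat\<close> is discrete, \<^typ>\<open>nat \<Rightarrow>\<^sub>C real\<close> is the space of all bounded real
  sequences with the supremum norm.\<close>

definition K :: "nat \<Rightarrow> (nat \<Rightarrow>\<^sub>C real) set" where
  "K n = {x. \<forall>k. apply_bcontfun x k \<in> real ` {0..n}}"

end

theory Submission imports Defs begin

text \<open>
  Membership of \<open>h\<close> in a weak* slice is, up to a small error, decided by the values of \<open>h\<close> on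
  a finite set, because elements of the free space are approximated by finite combinations of
  evaluations (\<open>lipschitz_free_slice_finite_support\<close>). Finitely many slices therefore involve a
  single finite set \<open>N\<close>, and in the \<open>i\<close>-th slice one may start from a function \<open>f\<^sub>i\<close> that is
  prescribed on \<open>N\<close> only and has Lipschitz constant \<open>1 - e\<close> there. What is needed is one function
  \<open>b\<close>, of norm almost 1 and zero on \<open>N\<close>, such that every \<open>f\<^sub>i\<close> extends from \<open>N\<close> to some \<open>g\<^sub>i\<close> with
  \<open>g\<^sub>i + b\<close> and \<open>g\<^sub>i - b\<close> both 1-Lipschitz.

  Such a \<open>b\<close> is built from two points \<open>u\<close> and \<open>v\<close>: a cone of height \<open>r\<close> over a ball around \<open>u\<close>
  minus a cone of height \<open>s\<close> over a ball around \<open>v\<close>, where \<open>r + s\<close> is almost \<open>dist u v\<close>. Both signs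
  can be accommodated provided that \<open>g\<^sub>i\<close> is constant, with the same value, on the two balls. The
  inequalities collected in \<open>trapezoid_pair\<close> guarantee such a value for every possible \<open>f\<^sub>i\<close>
  (\<open>trapezoid_pair_common_value\<close>); the extension then exists because it is an
  extension of a 1-Lipschitz function after each ball has been collapsed
  (\<open>trapezoid_pair_extension\<close>).

  It remains to find trapezoid pairs for every finite \<open>N\<close>. In an unbounded space, take \<open>v\<close> in \<open>N\<close>
  and \<open>u\<close> very far away. If arbitrarily small distances occur, then either some point \<open>v\<close> of \<open>N\<close> is
  an accumulation point and \<open>u\<close> is taken close to it, or all points of \<open>N\<close> are isolated and every
  sufficiently close pair stays away from \<open>N\<close>. In the discrete space and in \<open>K n\<close>, both
  heights are \<open>1/2\<close>; in the discrete space any two distinct points outside \<open>N\<close> serve. In \<open>K n\<close> with \<open>n \<le> 2\<close>, the pair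
  consists of two unit vectors that vanish on finitely many coordinates chosen so that any two points
  of \<open>N\<close> at distance 2 take the values 0 and 2 on one of them: there the point with value 2 is at
  distance 2 from both unit vectors.
\<close>

section \<open>Trapezoid pairs and extension of Lipschitz functions\<close>

text \<open>
  The first two families of inequalities leave an interval of admissible values of length at least
  \<open>2 * r\<close> at \<open>u\<close> and \<open>2 * s\<close> at \<open>v\<close>, for every \<open>(1 - e)\<close>-Lipschitz function on \<open>N\<close>, and the third
  family makes these intervals, shrunk by \<open>r\<close> and \<open>s\<close> at both ends, meet.
\<close>

definition trapezoid_pair :: "'a::metric_space set \<Rightarrow> real \<Rightarrow> 'a \<Rightarrow> 'a \<Rightarrow> real \<Rightarrow> real \<Rightarrow> bool" where
  "trapezoid_pair N e u v r s \<longleftrightarrow>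
     u \<noteq> v \<and> 0 \<le> r \<and> 0 \<le> s \<and> r + s \<le> dist u v \<and> (1 - e) * dist u v \<le> r + s \<and>
     (\<forall>x\<in>N. \<forall>y\<in>N.
        (1 - e) * dist x y + 2 * r \<le> dist x u + dist y u \<and>
        (1 - e) * dist x y + 2 * s \<le> dist x v + dist y v \<and>
        (1 - e) * dist x y + (r + s) \<le> dist x u + dist y v)"

definition bump_difference :: "'a::metric_space \<Rightarrow> real \<Rightarrow> 'a \<Rightarrow> real \<Rightarrow> 'a \<Rightarrow> real" where
  "bump_difference u r v s p = max 0 (r - dist p u) - max 0 (s - dist p v)"

text \<open>
  Each point of \<open>N\<close> gives lower and upper bounds for \<open>c\<close>. They are compatible by the defining
  inequalities of a trapezoid pair, so the largest of the lower bounds will do.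
\<close>

lemma trapezoid_pair_common_value:
  fixes f :: "'a::metric_space \<Rightarrow> real"
  assumes tp: "trapezoid_pair N e u v r s" and N: "finite N" "N \<noteq> {}"
    and f: "\<And>x y. x \<in> N \<Longrightarrow> y \<in> N \<Longrightarrow> \<bar>f x - f y\<bar> \<le> (1 - e) * dist x y"
  obtains c where "\<And>x. x \<in> N \<Longrightarrow> \<bar>f x - c\<bar> + r \<le> dist x u" "\<And>x. x \<in> N \<Longrightarrow> \<bar>f x - c\<bar> + s \<le> dist x v"
proof -
  define l where "l x = max (f x - dist x u + r) (f x - dist x v + s)" for x
  define c where "c = Max (l ` N)"
  have lower: "l x \<le> c" if "x \<in> N" for x
    using that N by (simp add: c_def)
  have "c \<in> l ` N"
    unfolding c_def using N by (intro Max_in) auto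
  then obtain z where z: "z \<in> N" "c = l z" by auto
  have upper: "c \<le> f y + dist y u - r \<and> c \<le> f y + dist y v - s" if "y \<in> N" for y
  proof -
    have "(1 - e) * dist z y + 2 * r \<le> dist z u + dist y u"
      "(1 - e) * dist z y + 2 * s \<le> dist z v + dist y v"
      "(1 - e) * dist z y + (r + s) \<le> dist z u + dist y v"
      using tp z(1) that unfolding trapezoid_pair_def by auto
    moreover have "(1 - e) * dist z y + (r + s) \<le> dist y u + dist z v"
      using tp z(1) that unfolding trapezoid_pair_def by (subst dist_commute) blast
    moreover note f[OF z(1) that]
    ultimately show ?thesis
      unfolding z(2) l_def by linarith
  qed
  show ?thesis
  proof (rule that)
    fix x assume x: "x \<in> N"
    show "\<bar>f x - c\<bar> + r \<le> dist x u" "\<bar>f x - c\<bar> + s \<le> dist x v"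
      using lower[OF x] upper[OF x] unfolding l_def by linarith+
  qed
qed

text \<open>
  The bound on the sum of the two absolute values is the same as 1-Lipschitz continuity of both
  \<open>g + b\<close> and \<open>g - b\<close>, where \<open>b\<close> is the bump difference. It holds because \<open>g\<close> differs from the common
  value \<open>c\<close> by no more than the distance to the ball of radius \<open>r\<close> around \<open>u\<close>, as measured by
  \<open>dist p u - r\<close>, and likewise for \<open>v\<close>: when exactly one of the two points lies in a ball, the
  variation of \<open>b\<close> is paid for by the part of the distance that is spent inside this ball.
\<close>

lemma trapezoid_pair_extension:
  fixes f :: "'a::metric_space \<Rightarrow> real"
  assumes tp: "trapezoid_pair N e u v r s" and N: "finite N" "N \<noteq> {}" and e: "0 \<le> e"
    and f: "\<And>x y. x \<in> N \<Longrightarrow> y \<in> N \<Longrightarrow> \<bar>f x - f y\<bar> \<le> (1 - e) * dist x y"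
  obtains g where "\<And>x. x \<in> N \<Longrightarrow> g x = f x"
    "\<And>p q. \<bar>g p - g q\<bar> + \<bar>bump_difference u r v s p - bump_difference u r v s q\<bar> \<le> dist p q"
proof -
  obtain c where cu: "\<And>x. x \<in> N \<Longrightarrow> \<bar>f x - c\<bar> + r \<le> dist x u"
    and cv: "\<And>x. x \<in> N \<Longrightarrow> \<bar>f x - c\<bar> + s \<le> dist x v"
    using trapezoid_pair_common_value[OF tp N f] by blast
  have rs: "0 \<le> r" "0 \<le> s" "r + s \<le> dist u v"
    using tp unfolding trapezoid_pair_def by auto
  \<comment> \<open>The function \<open>h\<close> is the McShane extension of \<open>f\<close>, the largest 1-Lipschitz one; \<open>g\<close> cuts
    it down to \<open>c\<close> on the two balls, by 1-Lipschitz barriers that do not affect the values on \<open>N\<close>.\<close>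
  define h where "h p = (MIN x\<in>N. f x + dist x p)" for p
  define g where "g p = min (h p) (c + min (max 0 (dist p u - r)) (max 0 (dist p v - s)))" for p
  have h_le: "h p \<le> f x + dist x p" if "x \<in> N" for x p
    unfolding h_def using N that by auto
  have h_attained: "\<exists>x\<in>N. h p = f x + dist x p" for p
  proof -
    have "h p \<in> (\<lambda>x. f x + dist x p) ` N"
      unfolding h_def using N by (intro Min_in) auto
    then show ?thesis by auto
  qed
  have h_Lip: "h p - h q \<le> dist p q" for p q
  proof -
    obtain x where "x \<in> N" "h q = f x + dist x q" using h_attained by blast
    then show ?thesis
      using h_le[of x p] dist_triangle[of x p q] by (simp add: dist_commute)
  qed
  have h_N: "h x = f x" if x: "x \<in> N" for x
  proof -
    obtain y where y: "y \<in> N" "h x = f y + dist y x" using h_attained by blast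
    have "0 \<le> e * dist x y" using e by simp
    then have "\<bar>f x - f y\<bar> \<le> dist x y" using f[OF x y(1)] by (simp add: algebra_simps)
    then show ?thesis
      using y(2) h_le[OF x, of x] by (simp add: dist_commute)
  qed
  have g_near: "\<bar>g p - c\<bar> \<le> max 0 (dist p u - r)" "\<bar>g p - c\<bar> \<le> max 0 (dist p v - s)" for p
  proof -
    obtain x where x: "x \<in> N" "h p = f x + dist x p" using h_attained by blast
    have "h p \<ge> c + r - dist p u" "h p \<ge> c + s - dist p v"
      using x(2) cu[OF x(1)] cv[OF x(1)] dist_triangle[of x u p] dist_triangle[of x v p]
      by linarith+
    then show "\<bar>g p - c\<bar> \<le> max 0 (dist p u - r)" "\<bar>g p - c\<bar> \<le> max 0 (dist p v - s)"
      unfolding g_def by linarith+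
  qed
  have one_sided: "g p - g q \<le> dist p q" for p q
    using h_Lip[of p q] dist_triangle[of p u q] dist_triangle[of p v q] zero_le_dist[of p q]
    unfolding g_def by (smt (verit))
  then have g_Lip: "\<bar>g p - g q\<bar> \<le> dist p q" for p q
    using one_sided[of p q] one_sided[of q p] by (simp add: dist_commute abs_le_iff)
  show ?thesis
  proof (rule that)
    fix x assume x: "x \<in> N"
    show "g x = f x"
      using cu[OF x] cv[OF x] unfolding g_def h_N[OF x] by linarith
  next
    fix p q
    have tri: "dist u v \<le> dist p u + dist p v" "dist u v \<le> dist q u + dist q v"
      "dist p u \<le> dist q u + dist p q" "dist q u \<le> dist p u + dist p q"
      "dist p v \<le> dist q v + dist p q" "dist q v \<le> dist p v + dist p q"
      "dist u v \<le> dist p u + dist p q + dist q v" "dist u v \<le> dist q u + dist p q + dist p v"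
      by metric+
    show "\<bar>g p - g q\<bar> + \<bar>bump_difference u r v s p - bump_difference u r v s q\<bar> \<le> dist p q"
      using g_near[of p] g_near[of q] g_Lip[of p q] tri rs
      unfolding bump_difference_def by (smt (verit))
  qed
qed

section \<open>Weak* slices of the unit ball of the Lipschitz space\<close>

lemma lip0_of_short_map:
  fixes f :: "'a::pointed_metric_space \<Rightarrow> real"
  assumes "f basepoint = 0" "\<And>x y. \<bar>f x - f y\<bar> \<le> dist x y"
  obtains F where "lip0_apply F = f" "norm F \<le> 1"
proof -
  have "1-lipschitz_on UNIV f"
    using assms(2) by (auto simp: lipschitz_on_def dist_real_def)
  then have F: "lip0_apply (Abs_lip0 f) = f"
    using assms(1) by (intro Abs_lip0_inverse) auto
  moreover have "norm (Abs_lip0 f) \<le> 1"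
    using assms(2) by (intro lip0_norm_le) (auto simp: F)
  ultimately show ?thesis using that by blast
qed

lemma span_delta_finite_support:
  assumes "\<nu> \<in> span (range delta)"
  shows "\<exists>N. finite N \<and> (\<forall>f g. (\<forall>x\<in>N. lip0_apply f x = lip0_apply g x) \<longrightarrow>
    blinfun_apply \<nu> f = blinfun_apply \<nu> g)"
  using assms
proof (induction rule: span_induct_alt)
  case base
  show ?case by (intro exI[of _ "{}"]) simp
next
  case (step c d \<nu>)
  obtain x where x: "d = delta x" using step by auto
  obtain N where N: "finite N"
    "\<And>f g. (\<forall>x\<in>N. lip0_apply f x = lip0_apply g x) \<Longrightarrow> blinfun_apply \<nu> f = blinfun_apply \<nu> g"
    using step by blast
  show ?case
    using N by (intro exI[of _ "insert x N"])
      (simp add: x delta.rep_eq blinfun.add_left blinfun.scaleR_left; metis)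
qed

text \<open>
  The factor \<open>1 - e\<close> is the slack that trapezoid pairs require; it costs little as long as \<open>e\<close> is
  small compared with the gap between \<open>t\<close> and the value at \<open>f\<close>.
\<close>

lemma lipschitz_free_slice_finite_support:
  assumes \<mu>: "\<mu> \<in> lipschitz_free" and f: "norm f \<le> 1" "t < blinfun_apply \<mu> f"
  shows "\<exists>N \<delta>. finite N \<and> 0 < \<delta> \<and>
    (\<forall>e g. 0 \<le> e \<longrightarrow> e \<le> \<delta> \<longrightarrow> norm g \<le> 1 \<longrightarrow>
       (\<forall>x\<in>N. lip0_apply g x = (1 - e) * lip0_apply f x) \<longrightarrow> t < blinfun_apply \<mu> g)"
proof -
  define \<gamma> where "\<gamma> = blinfun_apply \<mu> f - t"
  have \<gamma>: "0 < \<gamma>" using f by (simp add: \<gamma>_def)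
  then obtain \<nu> where \<nu>: "\<nu> \<in> span (range delta)" "dist \<nu> \<mu> < \<gamma> / 4"
    using \<mu> unfolding lipschitz_free_def closure_approachable
    by (metis divide_pos_pos zero_less_numeral)
  obtain N where N: "finite N"
    "\<And>f g. (\<forall>x\<in>N. lip0_apply f x = lip0_apply g x) \<Longrightarrow> blinfun_apply \<nu> f = blinfun_apply \<nu> g"
    using span_delta_finite_support[OF \<nu>(1)] by blast
  have approx: "\<bar>blinfun_apply \<nu> g - blinfun_apply \<mu> g\<bar> \<le> \<gamma> / 4" if "norm g \<le> 1" for g
  proof -
    have "\<bar>blinfun_apply \<nu> g - blinfun_apply \<mu> g\<bar> \<le> norm (\<nu> - \<mu>) * norm g"
      using norm_blinfun[of "\<nu> - \<mu>" g] by (simp add: blinfun.diff_left)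
    also have "\<dots> \<le> (\<gamma> / 4) * 1"
      using \<nu>(2) that \<gamma> by (intro mult_mono) (auto simp: dist_norm)
    finally show ?thesis by simp
  qed
  have \<nu>f: "blinfun_apply \<nu> f \<le> norm \<nu>"
    using norm_blinfun[of \<nu> f] mult_left_mono[OF f(1), of "norm \<nu>"] by simp
  \<comment> \<open>The gap \<open>\<gamma>\<close> is spent in quarters: two on replacing \<open>\<mu>\<close> by \<open>\<nu>\<close> and back, one on
    the factor \<open>1 - e\<close>.\<close>
  define \<delta> where "\<delta> = \<gamma> / (4 * (norm \<nu> + 1))"
  have "0 < norm \<nu> + 1" by (simp add: add_nonneg_pos)
  have \<delta>: "0 < \<delta>" "\<delta> * (norm \<nu> + 1) = \<gamma> / 4"
    using \<gamma> \<open>0 < norm \<nu> + 1\<close> by (auto simp: \<delta>_def simp del: distrib_left_numeral)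
  have "t < blinfun_apply \<mu> g"
    if e: "0 \<le> e" "e \<le> \<delta>" and g: "norm g \<le> 1"
      "\<forall>x\<in>N. lip0_apply g x = (1 - e) * lip0_apply f x" for e g
  proof -
    have "blinfun_apply \<nu> g = blinfun_apply \<nu> ((1 - e) *\<^sub>R f)"
      using g(2) by (intro N(2)) (simp add: scaleR_lip0.rep_eq)
    then have "blinfun_apply \<nu> g = blinfun_apply \<nu> f - e * blinfun_apply \<nu> f"
      by (simp add: blinfun.scaleR_right left_diff_distrib)
    moreover have "e * blinfun_apply \<nu> f \<le> \<delta> * (norm \<nu> + 1)"
    proof -
      have "e * blinfun_apply \<nu> f \<le> e * (norm \<nu> + 1)"
        using \<nu>f e(1) by (intro mult_left_mono) auto
      also have "\<dots> \<le> \<delta> * (norm \<nu> + 1)"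
        using e(2) by (intro mult_right_mono) auto
      finally show ?thesis .
    qed
    moreover have "blinfun_apply \<mu> f - \<gamma> / 4 \<le> blinfun_apply \<nu> f"
      "blinfun_apply \<nu> g - \<gamma> / 4 \<le> blinfun_apply \<mu> g"
      using abs_le_D2[OF approx[OF f(1)]] abs_le_D1[OF approx[OF g(1)]] by linarith+
    moreover have "t = blinfun_apply \<mu> f - \<gamma>"
      by (simp add: \<gamma>_def)
    ultimately show ?thesis
      using \<delta>(2) \<gamma> by linarith
  qed
  then show ?thesis using N(1) \<delta>(1) by blast
qed

lemma blinfun_norm_one_approx:
  fixes \<mu> :: "'y::real_normed_vector \<Rightarrow>\<^sub>L real"
  assumes "norm \<mu> = 1" "t < 1"
  shows "\<exists>f. norm f \<le> 1 \<and> t < blinfun_apply \<mu> f"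
proof (rule ccontr)
  assume "\<not> ?thesis"
  then have le: "blinfun_apply \<mu> f \<le> t" if "norm f \<le> 1" for f
    using that by (meson not_le)
  have t: "0 \<le> t" using le[of 0] by simp
  have "norm \<mu> \<le> t"
  proof (rule norm_blinfun_bound[OF t])
    fix f
    show "norm (blinfun_apply \<mu> f) \<le> t * norm f"
    proof (cases "f = 0")
      case False
      have "blinfun_apply \<mu> (f /\<^sub>R norm f) \<le> t" "blinfun_apply \<mu> (- (f /\<^sub>R norm f)) \<le> t"
        using False by (intro le; simp)+
      then show ?thesis
        using False by (auto simp: blinfun.scaleR_right blinfun.minus_right field_simps abs_le_iff)
    qed simp
  qed
  then show False using assms by simp
qed

text \<open>
  The base point is put into the finite set so that the extensions and the bump difference vanish
  there. The common direction \<open>y\<close> is the bump difference; its norm is tested on the pair \<open>u\<close>, \<open>v\<close>.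
\<close>

lemma wstar_SSD2P_lipschitz_free_if_trapezoid_pairs:
  assumes pairs: "\<And>(N :: 'a::pointed_metric_space set) e. finite N \<Longrightarrow> N \<noteq> {} \<Longrightarrow> 0 < e \<Longrightarrow> e < 1 \<Longrightarrow>
    \<exists>u v r s. trapezoid_pair N e u v r s"
  shows "wstar_SSD2P (lipschitz_free :: ('a lip0 \<Rightarrow>\<^sub>L real) set)"
  unfolding wstar_SSD2P_def
proof (intro allI impI, elim conjE)
  fix n :: nat and S :: "nat \<Rightarrow> 'a lip0 set" and \<epsilon> :: real
  assume S: "\<forall>i\<in>{1..n}. S i \<in> wstar_slices lipschitz_free" and \<epsilon>: "0 < \<epsilon>"
  have "\<exists>f N \<delta>. norm f \<le> 1 \<and> finite N \<and> 0 < \<delta> \<and>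
    (\<forall>e g. 0 \<le> e \<longrightarrow> e \<le> \<delta> \<longrightarrow> norm g \<le> 1 \<longrightarrow>
       (\<forall>x\<in>N. lip0_apply g x = (1 - e) * lip0_apply f x) \<longrightarrow> g \<in> S i)"
    if i: "i \<in> {1..n}" for i
  proof -
    obtain \<mu> \<alpha> where \<mu>: "S i = {y \<in> cball 0 1. blinfun_apply \<mu> y > 1 - \<alpha>}"
      "\<mu> \<in> lipschitz_free" "norm \<mu> = 1" "\<alpha> > 0"
      using S i unfolding wstar_slices_def by blast
    obtain f where f: "norm f \<le> 1" "1 - \<alpha> < blinfun_apply \<mu> f"
      using blinfun_norm_one_approx[of \<mu> "1 - \<alpha>"] \<mu> by auto
    show ?thesis
      using lipschitz_free_slice_finite_support[OF \<mu>(2) f] f(1)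
      unfolding \<mu>(1) by (simp only: mem_Collect_eq mem_cball_0) blast
  qed
  then obtain f N \<delta> where f: "\<And>i. i \<in> {1..n} \<Longrightarrow> norm (f i) \<le> 1"
    and N: "\<And>i. i \<in> {1..n} \<Longrightarrow> finite (N i)" and \<delta>: "\<And>i. i \<in> {1..n} \<Longrightarrow> 0 < \<delta> i"
    and inS: "\<And>i e g. i \<in> {1..n} \<Longrightarrow> 0 \<le> e \<Longrightarrow> e \<le> \<delta> i \<Longrightarrow> norm g \<le> 1 \<Longrightarrow>
       (\<forall>x\<in>N i. lip0_apply g x = (1 - e) * lip0_apply (f i) x) \<Longrightarrow> g \<in> S i"
    by metis
  define N' where "N' = insert basepoint (\<Union>i\<in>{1..n}. N i)"
  have N': "finite N'" "N' \<noteq> {}" "basepoint \<in> N'" "\<And>i. i \<in> {1..n} \<Longrightarrow> N i \<subseteq> N'"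
    using N by (auto simp: N'_def)
  define e where "e = Min (insert (1/2) (insert (\<epsilon>/2) (\<delta> ` {1..n})))"
  have e: "0 < e" "e < 1" "e < \<epsilon>" "\<And>i. i \<in> {1..n} \<Longrightarrow> e \<le> \<delta> i"
  proof -
    have "e \<le> 1/2" "e \<le> \<epsilon>/2" unfolding e_def by (intro Min_le; simp)+
    then show "e < 1" "e < \<epsilon>" using \<epsilon> by auto
    show "0 < e" using \<epsilon> \<delta> by (simp add: e_def)
    show "e \<le> \<delta> i" if "i \<in> {1..n}" for i
      unfolding e_def using that by (intro Min_le) auto
  qed
  obtain u v r s where tp: "trapezoid_pair N' e u v r s"
    using pairs[OF N'(1,2) e(1,2)] by blast
  let ?b = "bump_difference u r v s"
  have rs: "u \<noteq> v" "0 \<le> r" "0 \<le> s" "r + s \<le> dist u v" "(1 - e) * dist u v \<le> r + s"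
    using tp by (auto simp: trapezoid_pair_def)
  have b_N': "?b x = 0" if "x \<in> N'" for x
  proof -
    have "2 * r \<le> 2 * dist x u" "2 * s \<le> 2 * dist x v"
      using tp that unfolding trapezoid_pair_def by force+
    then show ?thesis by (simp add: bump_difference_def)
  qed
  have "\<exists>g. (\<forall>x\<in>N'. g x = (1 - e) * lip0_apply (f i) x) \<and>
      (\<forall>p q. \<bar>g p - g q\<bar> + \<bar>?b p - ?b q\<bar> \<le> dist p q)" if i: "i \<in> {1..n}" for i
  proof -
    have "\<bar>(1 - e) * lip0_apply (f i) x - (1 - e) * lip0_apply (f i) y\<bar> \<le> (1 - e) * dist x y" for x y
    proof -
      have "\<bar>lip0_apply (f i) x - lip0_apply (f i) y\<bar> \<le> 1 * dist x y"
        using lip0_diff_le[of "f i" x y] mult_right_mono[OF f[OF i], of "dist x y"] by simp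
      then have "(1 - e) * \<bar>lip0_apply (f i) x - lip0_apply (f i) y\<bar> \<le> (1 - e) * dist x y"
        using e by (intro mult_left_mono) auto
      then show ?thesis using e by (simp add: abs_mult flip: right_diff_distrib)
    qed
    then show ?thesis
      using trapezoid_pair_extension[OF tp N'(1,2) less_imp_le[OF e(1)],
          of "\<lambda>x. (1 - e) * lip0_apply (f i) x"] by metis
  qed
  then obtain g where g_N': "\<And>i x. i \<in> {1..n} \<Longrightarrow> x \<in> N' \<Longrightarrow> g i x = (1 - e) * lip0_apply (f i) x"
    and g_b: "\<And>i p q. i \<in> {1..n} \<Longrightarrow> \<bar>g i p - g i q\<bar> + \<bar>?b p - ?b q\<bar> \<le> dist p q"
    by metis
  have b_short: "\<bar>?b p - ?b q\<bar> \<le> dist p q" for p q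
  proof -
    have "\<bar>0 - 0 :: real\<bar> \<le> (1 - e) * dist x y" for x y :: 'a
      using e(2) by simp
    then obtain h where "\<And>p q. \<bar>h p - h q\<bar> + \<bar>?b p - ?b q\<bar> \<le> dist p q"
      using trapezoid_pair_extension[OF tp N'(1,2) less_imp_le[OF e(1)], of "\<lambda>_. 0"] by blast
    from this[of p q] show ?thesis by linarith
  qed
  obtain y where y: "lip0_apply y = ?b" "norm y \<le> 1"
    using lip0_of_short_map[of ?b] b_N'[OF N'(3)] b_short by blast
  have "\<exists>x. lip0_apply x = g i \<and> x \<in> S i \<and> x + y \<in> S i \<and> x - y \<in> S i" if i: "i \<in> {1..n}" for i
  proof -
    have mem: "\<exists>z. lip0_apply z = h \<and> z \<in> S i"
      if h: "\<And>x. x \<in> N' \<Longrightarrow> h x = g i x" "\<And>p q. \<bar>h p - h q\<bar> \<le> \<bar>g i p - g i q\<bar> + \<bar>?b p - ?b q\<bar>" for h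
    proof -
      have "h basepoint = 0"
        using h(1) g_N'[OF i] N'(3) by (simp add: lip0_basepoint)
      moreover have "\<bar>h p - h q\<bar> \<le> dist p q" for p q
        using h(2) g_b[OF i] order_trans by blast
      ultimately obtain z where z: "lip0_apply z = h" "norm z \<le> 1"
        using lip0_of_short_map[of h] by blast
      have "z \<in> S i"
        using h(1) g_N'[OF i] N'(4)[OF i] e(1)
        by (intro inS[OF i _ e(4)[OF i] z(2)]) (auto simp: z(1))
      with z show ?thesis by blast
    qed
    obtain x where x: "lip0_apply x = g i" "x \<in> S i"
      using mem[of "g i"] by auto
    obtain x1 where x1: "lip0_apply x1 = (\<lambda>p. g i p + ?b p)" "x1 \<in> S i"
      using mem[of "\<lambda>p. g i p + ?b p"] b_N' by force
    obtain x2 where x2: "lip0_apply x2 = (\<lambda>p. g i p - ?b p)" "x2 \<in> S i"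
      using mem[of "\<lambda>p. g i p - ?b p"] b_N' by force
    have "x1 = x + y" "x2 = x - y"
      using x y x1 x2
      by (simp_all add: lip0_apply_inject[symmetric] plus_lip0.rep_eq minus_lip0.rep_eq)
    with x x1 x2 show ?thesis by auto
  qed
  then obtain x where x: "\<forall>i\<in>{1..n}. x i \<in> S i \<and> x i + y \<in> S i \<and> x i - y \<in> S i"
    by metis
  have "?b u - ?b v = r + s"
    using rs by (simp add: bump_difference_def dist_commute)
  then have "(1 - e) * dist u v \<le> norm y * dist u v"
    using lip0_diff_le[of y u v] rs(5) unfolding y(1) by linarith
  then have "1 - e \<le> norm y"
    by (rule mult_right_le_imp_le) (simp add: rs(1))
  then have "norm y > 1 - \<epsilon>" using e(3) by simp
  with x y(2) show "\<exists>x. \<exists>y\<in>cball 0 1.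
      (\<forall>i\<in>{1..n}. x i \<in> S i \<and> x i + y \<in> S i \<and> x i - y \<in> S i) \<and> norm y > 1 - \<epsilon>"
    by (intro exI[of _ x] bexI[of _ y]) auto
qed

section \<open>Trapezoid pairs for large and for small distances\<close>

text \<open>
  A single cone, over a ball around \<open>u\<close>, is used whenever the relevant feature of the space is a
  very large or very small distance; the condition at \<open>v\<close> is then the triangle inequality.
\<close>

lemma trapezoid_pair_one_sided:
  assumes "u \<noteq> v" "0 \<le> e" "e \<le> 1"
    and "\<And>x y. x \<in> N \<Longrightarrow> y \<in> N \<Longrightarrow> (1 - e) * (dist x y + 2 * dist u v) \<le> dist x u + dist y u"
    and "\<And>x y. x \<in> N \<Longrightarrow> y \<in> N \<Longrightarrow> (1 - e) * (dist x y + dist u v) \<le> dist x u + dist y v"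
  shows "trapezoid_pair N e u v ((1 - e) * dist u v) 0"
proof -
  have shrink: "(1 - e) * d \<le> d" if "0 \<le> d" for d :: real
    using assms(2) that by (simp add: algebra_simps)
  have "(1 - e) * dist x y \<le> dist x v + dist y v" for x y
    using shrink[of "dist x y"] dist_triangle2[of x y v] by simp
  then show ?thesis
    using assms shrink[of "dist u v"] by (auto simp: trapezoid_pair_def distrib_left mult.assoc mult.left_commute)
qed

text \<open>
  Once \<open>e * dist u v\<close> exceeds twice the radius of \<open>N\<close> about \<open>v\<close>, the slack
  absorbs all distances inside \<open>N\<close>.
\<close>

lemma trapezoid_pair_unbounded:
  fixes N :: "'a::metric_space set"
  assumes unbdd: "\<And>C. \<exists>x y :: 'a. C < dist x y" and N: "finite N" "N \<noteq> {}" and e: "0 < e" "e < 1"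
  shows "\<exists>u v r s. trapezoid_pair N e u v r s"
proof -
  obtain v where v: "v \<in> N" using N by blast
  define R where "R = Max ((\<lambda>x. dist x v) ` N)"
  have R: "dist x v \<le> R" if "x \<in> N" for x
    using that N by (simp add: R_def)
  have "0 \<le> R" using R[OF v] by simp
  obtain x y :: 'a where "4 * (R / e) < dist x y" using unbdd by blast
  then have "2 * (R / e) < dist x v \<or> 2 * (R / e) < dist y v"
    using dist_triangle2[of x y v] by linarith
  then obtain u where "2 * (R / e) < dist u v" by blast
  then have u: "2 * R < e * dist u v" using e by (simp add: field_simps)
  have "u \<noteq> v" using u \<open>0 \<le> R\<close> by auto
  moreover have "(1 - e) * (dist x y + 2 * dist u v) \<le> dist x u + dist y u"
    if "x \<in> N" "y \<in> N" for x y
  proof -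
    have "(1 - e) * (dist x y + 2 * dist u v) = dist x y - e * dist x y + 2 * dist u v - 2 * (e * dist u v)"
      by (simp add: algebra_simps)
    moreover have "0 \<le> e * dist x y" using e by simp
    moreover have "dist x y \<le> dist x v + dist y v" "dist u v \<le> dist x u + dist x v"
      "dist u v \<le> dist y u + dist y v" by metric+
    ultimately show ?thesis
      using u R[OF that(1)] R[OF that(2)] by linarith
  qed
  moreover have "(1 - e) * (dist x y + dist u v) \<le> dist x u + dist y v"
    if "x \<in> N" "y \<in> N" for x y
  proof -
    have "(1 - e) * (dist x y + dist u v) = dist x y - e * dist x y + dist u v - e * dist u v"
      by (simp add: algebra_simps)
    moreover have "0 \<le> e * dist x y" using e by simp
    moreover have "dist x y \<le> dist x v + dist y v" "dist u v \<le> dist x u + dist x v" by metric+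
    ultimately show ?thesis
      using u R[OF that(1)] by linarith
  qed
  ultimately show ?thesis
    using trapezoid_pair_one_sided[of u v e N] e by fastforce
qed

text \<open>
  If \<open>x = y = v\<close>, the inequalities hold because the height is at most \<open>dist u v\<close>. As soon as another
  point \<open>x\<close> of \<open>N\<close> is involved, the slack \<open>e * dist x v\<close> dominates \<open>2 * dist u v\<close>.
\<close>

lemma trapezoid_pair_accumulation_point:
  assumes v: "v islimpt UNIV" "v \<in> N" and N: "finite N" and e: "0 < e" "e < 1"
  shows "\<exists>u v r s. trapezoid_pair N e u v r s"
proof -
  obtain m where m: "m > 0" "\<And>x. x \<in> N \<Longrightarrow> x \<noteq> v \<Longrightarrow> m \<le> dist v x"
    using finite_set_avoid[OF N] by metis
  obtain u where u: "u \<noteq> v" "dist u v < e * m / 2"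
    using v(1) m(1) e(1) unfolding islimpt_approachable
    by (metis UNIV_I half_gt_zero mult_pos_pos)
  have far: "2 * dist u v \<le> e * dist x v" "2 * dist u v \<le> dist x v" if "x \<in> N" "x \<noteq> v" for x
  proof -
    have "e * m \<le> e * dist x v"
      using m(2)[OF that] e by (intro mult_left_mono) (auto simp: dist_commute)
    then show "2 * dist u v \<le> e * dist x v" using u(2) by simp
    also have "e * dist x v \<le> 1 * dist x v" using e by (intro mult_right_mono) auto
    finally show "2 * dist u v \<le> dist x v" by simp
  qed
  have shrink: "(1 - e) * d \<le> d" if "0 \<le> d" for d :: real
    using e that by (simp add: algebra_simps)
  have A0: "(1 - e) * (dist v y + 2 * dist u v) \<le> dist v u + dist y u" if "y \<in> N" for y
  proof (cases "y = v")
    case True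
    then show ?thesis using shrink[of "2 * dist u v"] by (simp add: dist_commute)
  next
    case False
    have "(1 - e) * (dist v y + 2 * dist u v) = dist v y - e * dist v y + 2 * dist u v - e * (2 * dist u v)"
      by (simp add: algebra_simps)
    moreover have "0 \<le> e * (2 * dist u v)" using e by simp
    moreover have "dist v y \<le> dist v u + dist y u" by metric
    ultimately show ?thesis using far(1)[OF that False] by (simp add: dist_commute)
  qed
  have "(1 - e) * (dist x y + 2 * dist u v) \<le> dist x u + dist y u"
    if "x \<in> N" "y \<in> N" for x y
  proof (cases "x = v \<or> y = v")
    case True
    then show ?thesis using A0[OF that(1)] A0[OF that(2)] by (auto simp: dist_commute add.commute)
  next
    case False
    define D where "D = dist x u + dist y u"
    have "dist x v + dist y v - 2 * dist u v \<le> D" "dist x y \<le> D" unfolding D_def by metric+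
    then have "e * (dist x v + dist y v - 2 * dist u v) \<le> e * D"
        "(1 - e) * (dist x y + 2 * dist u v) \<le> (1 - e) * (D + 2 * dist u v)"
      using e by (intro mult_left_mono; simp)+
    moreover have "2 * dist u v \<le> e * dist x v" "2 * dist u v \<le> e * dist y v"
      using False far that by auto
    ultimately show ?thesis unfolding D_def[symmetric]
      by (simp add: algebra_simps) (smt (verit) zero_le_dist)
  qed
  moreover have "(1 - e) * (dist x y + dist u v) \<le> dist x u + dist y v"
    if "x \<in> N" "y \<in> N" for x y
  proof (cases "x = v")
    case True
    then show ?thesis using shrink[of "dist x y + dist u v"] by (simp add: dist_commute)
  next
    case False
    have "(1 - e) * (dist x y + dist u v) \<le> (1 - e) * (dist x v + (dist y v + dist u v))"
      using e dist_triangle2[of x y v] by (intro mult_left_mono) auto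
    moreover have "(1 - e) * (dist y v + dist u v) \<le> dist y v + dist u v"
      by (intro shrink) simp
    moreover have "dist x v \<le> dist x u + dist u v" by metric
    ultimately show ?thesis using far[OF that(1) False] by (simp add: algebra_simps)
  qed
  ultimately show ?thesis
    using trapezoid_pair_one_sided[of u v e N] e u(1) by fastforce
qed

text \<open>
  Isolation of the finitely many points of \<open>N\<close> bounds their distances to all other points from below
  by some \<open>\<delta>\<close>. A pair closer than \<open>\<delta>\<close> therefore lies outside \<open>N\<close>, and all distances from
  \<open>N\<close> to the pair are at least \<open>2 * dist u v / e\<close>.
\<close>

lemma trapezoid_pair_away:
  fixes N :: "'a::metric_space set"
  assumes small: "\<And>\<eta>. 0 < \<eta> \<Longrightarrow> \<exists>x y :: 'a. x \<noteq> y \<and> dist x y < \<eta>"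
    and isolated: "\<And>x. x \<in> N \<Longrightarrow> \<not> x islimpt UNIV" and N: "finite N" and e: "0 < e" "e < 1"
  shows "\<exists>u v r s. trapezoid_pair N e u v r s"
proof -
  have "\<exists>\<delta>>0. \<forall>u. u \<noteq> x \<longrightarrow> \<delta> \<le> dist x u" if "x \<in> N" for x
    using isolated[OF that] unfolding islimpt_approachable by (auto simp: not_less dist_commute)
  then obtain d where d: "\<And>x. x \<in> N \<Longrightarrow> 0 < d x" "\<And>x u. x \<in> N \<Longrightarrow> u \<noteq> x \<Longrightarrow> d x \<le> dist x u"
    by metis
  define \<delta> where "\<delta> = Min (insert 1 (d ` N))"
  have \<delta>: "0 < \<delta>" using d(1) N by (simp add: \<delta>_def)
  have sep: "\<delta> \<le> dist x u" if "x \<in> N" "u \<noteq> x" for x u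
  proof -
    have "\<delta> \<le> d x" unfolding \<delta>_def using that N by (intro Min_le) auto
    with d(2)[OF that] show ?thesis by simp
  qed
  obtain u v :: 'a where uv: "u \<noteq> v" "dist u v < e * \<delta> / 2"
    using small[of "e * \<delta> / 2"] \<delta> e by auto
  have "e * \<delta> \<le> 1 * \<delta>" using e \<delta> by (intro mult_right_mono) auto
  then have "dist u v < \<delta>" using uv(2) \<delta> by linarith
  then have "u \<notin> N" "v \<notin> N"
    using sep[of u v] sep[of v u] uv(1) by (auto simp: dist_commute)
  have far: "2 * dist u v \<le> e * dist x u" "2 * dist u v \<le> e * dist x v" if "x \<in> N" for x
  proof -
    have "\<delta> \<le> dist x u" "\<delta> \<le> dist x v"
      using that sep \<open>u \<notin> N\<close> \<open>v \<notin> N\<close> by metis+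
    then have "e * \<delta> \<le> e * dist x u" "e * \<delta> \<le> e * dist x v" using e by simp_all
    then show "2 * dist u v \<le> e * dist x u" "2 * dist u v \<le> e * dist x v" using uv(2) by simp_all
  qed
  have "(1 - e) * (dist x y + 2 * dist u v) \<le> dist x u + dist y u" if "x \<in> N" "y \<in> N" for x y
  proof -
    have "(1 - e) * (dist x y + 2 * dist u v) \<le> (1 - e) * (dist x u + dist y u + 2 * dist u v)"
      using e dist_triangle2[of x y u] by (intro mult_left_mono) auto
    moreover have "\<dots> = dist x u + dist y u + 2 * dist u v - e * dist x u - e * dist y u - e * (2 * dist u v)"
      by (simp add: algebra_simps)
    moreover have "0 \<le> e * (2 * dist u v)" using e by simp
    ultimately show ?thesis
      using far(1)[OF that(1)] far(1)[OF that(2)] zero_le_dist[of u v] by linarith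
  qed
  moreover have "(1 - e) * (dist x y + dist u v) \<le> dist x u + dist y v" if "x \<in> N" "y \<in> N" for x y
  proof -
    have "dist x y \<le> dist x u + dist y v + dist u v" by metric
    then have "(1 - e) * (dist x y + dist u v) \<le> (1 - e) * (dist x u + dist y v + 2 * dist u v)"
      using e by (intro mult_left_mono) auto
    moreover have "\<dots> = dist x u + dist y v + 2 * dist u v - e * dist x u - e * dist y v - e * (2 * dist u v)"
      by (simp add: algebra_simps)
    moreover have "0 \<le> e * (2 * dist u v)" using e by simp
    ultimately show ?thesis
      using far(1)[OF that(1)] far(2)[OF that(2)] zero_le_dist[of u v] by linarith
  qed
  ultimately show ?thesis
    using trapezoid_pair_one_sided[of u v e N] e uv(1) by fastforce
qed

section \<open>Trapezoid pairs in discrete spaces and in grids\<close>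

lemma trapezoid_pair_half_half:
  assumes uv: "dist u v = 1" and e: "0 \<le> e"
    and far: "\<And>x y a b. x \<in> N \<Longrightarrow> y \<in> N \<Longrightarrow> a \<in> {u, v} \<Longrightarrow> b \<in> {u, v} \<Longrightarrow>
      dist x y + 1 \<le> dist x a + dist y b"
  shows "trapezoid_pair N e u v (1/2) (1/2)"
proof -
  have "(1 - e) * dist x y \<le> dist x y" for x y :: 'a
    using e by (simp add: algebra_simps)
  then have "(1 - e) * dist x y + 1 \<le> dist x a + dist y b"
    if "x \<in> N" "y \<in> N" "a \<in> {u, v}" "b \<in> {u, v}" for x y a b
    using far[OF that] by (meson add_right_mono order_trans)
  then show ?thesis
    using uv e by (auto simp: trapezoid_pair_def)
qed

lemma trapezoid_pair_discrete:
  fixes N :: "'a::metric_space set"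
  assumes inf: "infinite (UNIV :: 'a set)" and discrete: "\<And>x y :: 'a. x \<noteq> y \<Longrightarrow> dist x y = 1"
    and N: "finite N" and e: "0 \<le> e"
  shows "\<exists>u v r s. trapezoid_pair N e u v r s"
proof -
  obtain u where u: "u \<notin> N" using ex_new_if_finite[OF inf N] by blast
  obtain v where v: "v \<notin> insert u N" using ex_new_if_finite[OF inf, of "insert u N"] N by blast
  have "dist x y \<le> 1" for x y :: 'a using discrete[of x y] by (cases "x = y") auto
  moreover have "dist x a = 1" if "x \<in> N" "a \<in> {u, v}" for x a
    using that u v discrete[of x a] by auto
  ultimately have "trapezoid_pair N e u v (1/2) (1/2)"
    using discrete[of u v] v by (intro trapezoid_pair_half_half e) auto
  then show ?thesis by blast
qed

text \<open>
  All coordinates are integers between 0 and 2, so the supremum defining the distance is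
  attained, and two coordinates differ by 2 only if they are 0 and 2.
\<close>

lemma dist_K_cases:
  assumes x: "x \<in> K n" and y: "y \<in> K n" and n: "n \<le> 2" and ne: "x \<noteq> y"
  shows "dist x y = 1 \<or> dist x y = 2 \<and> (\<exists>k. {apply_bcontfun x k, apply_bcontfun y k} = {0, 2})"
proof -
  have val: "apply_bcontfun z k \<in> {0, 1, 2}" if "z \<in> K n" for z k
  proof -
    obtain i where "apply_bcontfun z k = real i" "i \<le> 2"
      using \<open>z \<in> K n\<close> n unfolding K_def by fastforce
    then show ?thesis by (auto simp: le_Suc_eq numeral_2_eq_2)
  qed
  have le: "dist (apply_bcontfun x k) (apply_bcontfun y k) \<le> dist x y" for k
    by (rule dist_bounded)
  obtain k where k: "apply_bcontfun x k \<noteq> apply_bcontfun y k"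
    using ne by (meson bcontfun_eqI)
  have ge1: "1 \<le> dist x y"
    using le[of k] k val[OF x, of k] val[OF y, of k] by (auto simp: dist_real_def)
  show ?thesis
  proof (cases "\<exists>k. {apply_bcontfun x k, apply_bcontfun y k} = {0, 2}")
    case True
    then obtain j where j: "{apply_bcontfun x j, apply_bcontfun y j} = {0, 2}" by blast
    then have "2 \<le> dist x y" using le[of j] by (auto simp: doubleton_eq_iff dist_real_def)
    moreover have "dist x y \<le> 2"
    proof (rule dist_bound)
      fix k
      show "dist (apply_bcontfun x k) (apply_bcontfun y k) \<le> 2"
        using val[OF x, of k] val[OF y, of k] by (auto simp: dist_real_def)
    qed
    ultimately show ?thesis using True by simp
  next
    case False
    have "dist x y \<le> 1"
    proof (rule dist_bound)
      fix k
      show "dist (apply_bcontfun x k) (apply_bcontfun y k) \<le> 1"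
        using val[OF x, of k] val[OF y, of k] False by (auto simp: dist_real_def)
    qed
    with ge1 show ?thesis by simp
  qed
qed

lemma K_unit_vectors:
  obtains E where "inj E" "\<And>i k. apply_bcontfun (E i) k = (if k = i then 1 else 0 :: real)"
    "\<And>n i. 1 \<le> n \<Longrightarrow> E i \<in> K n"
proof -
  define E :: "nat \<Rightarrow> nat \<Rightarrow>\<^sub>C real" where "E i = Bcontfun (\<lambda>k. if k = i then 1 else 0)" for i
  have E: "apply_bcontfun (E i) k = (if k = i then 1 else 0)" for i k
  proof -
    have "(\<lambda>k. if k = i then 1 else 0 :: real) \<in> bcontfun"
      by (rule bcontfun_normI[of _ 1]) auto
    then show ?thesis by (simp add: E_def Bcontfun_inverse)
  qed
  have "inj E"
    by (rule injI) (metis E zero_neq_one)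
  moreover have "E i \<in> K n" if "1 \<le> n" for n i
  proof -
    have "real 0 \<in> real ` {0..n}" "real 1 \<in> real ` {0..n}" using that by (intro imageI; simp)+
    then show ?thesis by (simp add: K_def E)
  qed
  ultimately show ?thesis using that E by blast
qed

text \<open>
  Both members of the pair lie outside \<open>N\<close>, so their distances to \<open>N\<close> are at least 1, which settles
  \<open>dist x y \<le> 1\<close>. If \<open>dist x y = 2\<close>, a coordinate in \<open>F\<close> shows that one of \<open>x\<close>, \<open>y\<close> is at distance
  2 from every point that vanishes on \<open>F\<close>, hence from \<open>u\<close> and from \<open>v\<close> alike.
\<close>

lemma trapezoid_pair_K:
  fixes \<phi> :: "'a::metric_space \<Rightarrow> (nat \<Rightarrow>\<^sub>C real)" and N :: "'a set"
  assumes n: "n \<in> {1, 2}" and iso: "\<And>x y. dist (\<phi> x) (\<phi> y) = dist x y" and range: "range \<phi> = K n"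
    and N: "finite N" and e: "0 \<le> e"
  shows "\<exists>u v r s. trapezoid_pair N e u v r s"
proof -
  obtain E where E: "inj E" "\<And>i k. apply_bcontfun (E i) k = (if k = i then 1 else 0 :: real)"
    "\<And>n i. 1 \<le> n \<Longrightarrow> E i \<in> K n"
    using K_unit_vectors by blast
  have \<phi>K: "\<phi> x \<in> K n" for x using range by blast
  have n2: "n \<le> 2" using n by auto
  have cases: "x = y \<or> dist x y = 1 \<or>
      dist x y = 2 \<and> (\<exists>k. {apply_bcontfun (\<phi> x) k, apply_bcontfun (\<phi> y) k} = {0, 2})" for x y
    using dist_K_cases[OF \<phi>K[of x] \<phi>K[of y] n2] iso[of x y] by (metis dist_eq_0_iff)
  have dist2I: "2 \<le> dist x y" if "apply_bcontfun (\<phi> x) k = 2" "apply_bcontfun (\<phi> y) k = 0" for x y k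
    using dist_bounded[of "\<phi> x" k "\<phi> y"] that by (simp add: iso)
  \<comment> \<open>\<open>F\<close> contains, for any two points of \<open>N\<close> at distance 2, a coordinate where this distance is
    attained.\<close>
  define w where "w x y = (SOME k. {apply_bcontfun (\<phi> x) k, apply_bcontfun (\<phi> y) k} = {0, 2})" for x y
  define F where "F = (\<Union>x\<in>N. w x ` N)"
  have F: "\<exists>k\<in>F. {apply_bcontfun (\<phi> x) k, apply_bcontfun (\<phi> y) k} = {0, 2}"
    if "x \<in> N" "y \<in> N" "dist x y = 2" for x y
  proof -
    have "\<exists>k. {apply_bcontfun (\<phi> x) k, apply_bcontfun (\<phi> y) k} = {0, 2}"
      using cases[of x y] that by auto
    then have "{apply_bcontfun (\<phi> x) (w x y), apply_bcontfun (\<phi> y) (w x y)} = {0, 2}"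
      unfolding w_def by (rule someI_ex)
    then show ?thesis using that unfolding F_def by blast
  qed
  have fin: "finite (F \<union> E -` (\<phi> ` N))"
    using N E(1) by (auto simp: F_def intro: finite_vimageI)
  then obtain k where k: "k \<notin> F \<union> E -` (\<phi> ` N)"
    using ex_new_if_finite[OF infinite_UNIV_nat] by blast
  obtain l where l: "l \<notin> insert k (F \<union> E -` (\<phi> ` N))"
    using ex_new_if_finite[OF infinite_UNIV_nat, of "insert k (F \<union> E -` (\<phi> ` N))"] fin by auto
  have "E i \<in> range \<phi>" for i using E(3) n range by auto
  then obtain u v where uv: "\<phi> u = E k" "\<phi> v = E l" by (metis rangeE)
  have "\<phi> u \<notin> \<phi> ` N" "\<phi> v \<notin> \<phi> ` N" using k l by (simp_all add: uv)
  then have notin: "u \<notin> N" "v \<notin> N" by blast+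
  have zero: "apply_bcontfun (\<phi> a) j = 0" if "a \<in> {u, v}" "j \<in> F" for a j
    using that k l by (auto simp: uv E(2))
  have "u \<noteq> v" using uv E(1) l by (auto dest: injD)
  moreover have "{apply_bcontfun (\<phi> u) j, apply_bcontfun (\<phi> v) j} \<noteq> {0, 2}" for j
    by (auto simp: uv E(2) doubleton_eq_iff)
  ultimately have uv1: "dist u v = 1" using cases[of u v] by blast
  have "dist x y + 1 \<le> dist x a + dist y b"
    if xy: "x \<in> N" "y \<in> N" and ab: "a \<in> {u, v}" "b \<in> {u, v}" for x y a b
  proof -
    have ge1: "1 \<le> dist x a" "1 \<le> dist y b"
    proof -
      have "x \<noteq> a" "y \<noteq> b" using notin xy ab by auto
      then show "1 \<le> dist x a" "1 \<le> dist y b" using cases[of x a] cases[of y b] by linarith+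
    qed
    show ?thesis
    proof (cases "dist x y = 2")
      case True
      then obtain j where j: "j \<in> F" "{apply_bcontfun (\<phi> x) j, apply_bcontfun (\<phi> y) j} = {0, 2}"
        using F xy by blast
      then have "apply_bcontfun (\<phi> x) j = 2 \<or> apply_bcontfun (\<phi> y) j = 2"
        by (auto simp: doubleton_eq_iff)
      then have "2 \<le> dist x a \<or> 2 \<le> dist y b"
        using dist2I[OF _ zero[OF ab(1) j(1)]] dist2I[OF _ zero[OF ab(2) j(1)]] by blast
      then show ?thesis using ge1 True by auto
    next
      case False
      then have "dist x y \<le> 1" using cases[of x y] by fastforce
      then show ?thesis using ge1 by simp
    qed
  qed
  then show ?thesis
    using trapezoid_pair_half_half[OF uv1 e] by blast
qed

section \<open>The symmetric strong diameter 2 property\<close>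

theorem theorem5p6:
  assumes "infinite (UNIV :: 'a::pointed_metric_space set)"
    and "Sup {ereal (dist x y) | x y :: 'a. x \<noteq> y} = \<infinity>
       \<or> Inf {dist x y | x y :: 'a. x \<noteq> y} = 0
       \<or> (\<forall>x y :: 'a. x \<noteq> y \<longrightarrow> dist x y = 1)
       \<or> (\<exists>n\<in>{1, 2}. \<exists>\<phi> :: 'a \<Rightarrow> (nat \<Rightarrow>\<^sub>C real).
            (\<forall>x y. dist (\<phi> x) (\<phi> y) = dist x y) \<and> range \<phi> = K n)"
  shows "wstar_SSD2P (lipschitz_free :: ('a lip0 \<Rightarrow>\<^sub>L real) set)"
proof (rule wstar_SSD2P_lipschitz_free_if_trapezoid_pairs)
  fix N :: "'a set" and e :: real
  assume N: "finite N" "N \<noteq> {}" and e: "0 < e" "e < 1"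
  from assms(2) show "\<exists>u v r s. trapezoid_pair N e u v r s"
  proof (elim disjE bexE exE conjE)
    assume sup: "Sup {ereal (dist x y) | x y :: 'a. x \<noteq> y} = \<infinity>"
    have "\<exists>x y :: 'a. C < dist x y" for C
    proof -
      have "ereal C < Sup {ereal (dist x y) | x y :: 'a. x \<noteq> y}" by (simp add: sup)
      then show ?thesis unfolding less_Sup_iff by force
    qed
    then show ?thesis using trapezoid_pair_unbounded N e by blast
  next
    assume inf: "Inf {dist x y | x y :: 'a. x \<noteq> y} = 0"
    have small: "\<exists>x y :: 'a. x \<noteq> y \<and> dist x y < \<eta>" if "0 < \<eta>" for \<eta>
    proof -
      obtain a :: 'a where "a \<noteq> basepoint"
        using ex_new_if_finite[OF assms(1), of "{basepoint}"] by auto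
      then have "{dist x y | x y :: 'a. x \<noteq> y} \<noteq> {}" by blast
      then show ?thesis
        using cInf_lessD[of "{dist x y | x y :: 'a. x \<noteq> y}" \<eta>] inf that by auto
    qed
    show ?thesis
      using trapezoid_pair_accumulation_point[OF _ _ N(1) e] trapezoid_pair_away[OF small _ N(1) e]
      by blast
  next
    assume "\<forall>x y :: 'a. x \<noteq> y \<longrightarrow> dist x y = 1"
    then show ?thesis using trapezoid_pair_discrete[OF assms(1) _ N(1)] e by auto
  next
    fix n and \<phi> :: "'a \<Rightarrow> (nat \<Rightarrow>\<^sub>C real)"
    assume "n \<in> {1, 2}" "\<forall>x y. dist (\<phi> x) (\<phi> y) = dist x y" "range \<phi> = K n"
    then show ?thesis using trapezoid_pair_K[of n \<phi> N e] N e by auto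
  qed
qed

end
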